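(* Let $X$ be a nonempty compact metric space and let $f_{1,\infty} = (f_n)_{n=1}^\infty$ be a nonautonomous dynamical system on $X$. Consider the following conditions on $f_{1,\infty}$. (D$\omega$) There is a dense $G_\delta$ set $A\subset X$ such that $\omega_{f_{1,\infty}}(x) = X$ for every $x\in A$. (TT) For every pair of nonempty open sets $U,V\subset X$ there is an $n\in\mathbb{N}$ such that $f_{1,n}(U)\cap V\neq\emptyset$. (TT$^{-}$) For every pair of nonempty open sets $U,V\subset X$ there is an $n\in\mathbb{N}$ such that $f_{1,n}^{-1}(U)\cap V\neq\emptyset$. (OP) For every nonempty open $U\subset X$ the set $\bigcup_{n=1}^\infty f_{1,n}(U)$ is dense in $X$. (OP$^{-}$) For every nonempty open $U\subset X$ the set $\bigcup_{n=1}^\infty f_{1,n}^{-1}(U)$ is dense in $X$. (TT$_0$) For every pair of nonempty open sets $U,V\subset X$ there is an $n\in\mathbb{N}\cup\{0\}$ such that $f_{1,n}(U)\cap V\neq\emptyset$. (TT$_0^{-}$) For every pair of nonempty open sets $U,V\subset X$ there is an $n\in\mathbb{N}\cup\{0\}$ such that $f_{1,n}^{-1}(U)\cap V\neq\emptyset$. (OP$_0$) For every nonempty open $U\subset X$ the set $\bigcup_{n=0}^\infty f_{1,n}(U)$ is dense in $X$. (OP$_0^{-}$) For every nonempty open $U\subset X$ the set $\bigcup_{n=0}^\infty f_{1,n}^{-1}(U)$ is dense in $X$. (DDO) There is a dense $G_\delta$ set $A\subset X$ such that $\operatorname{Orb}_{f_{1,\infty}}(x)$ is dense in $X$ for every $x\in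 A$. (DO) There is an $x\in X$ whose orbit $\operatorname{Orb}_{f_{1,\infty}}(x)$ is dense in $X$. ($\omega$) There is an $x\in X$ such that $\omega_{f_{1,\infty}}(x) = X$. Then: 1. The four conditions TT, TT$^{-}$, OP, OP$^{-}$ are equivalent to each other, and the five conditions TT$_0$, TT$_0^{-}$, OP$_0$, OP$_0^{-}$, DDO are equivalent to each other. 2. D$\omega$ implies each of TT, TT$^{-}$, OP, OP$^{-}$; each of these implies each of TT$_0$, TT$_0^{-}$, OP$_0$, OP$_0^{-}$, DDO; and each of the latter implies DO. None of the converse implications holds in general: there are nonautonomous dynamical systems on nonempty compact metric spaces satisfying TT but not D$\omega$, satisfying TT$_0$ but not TT, and satisfying DO but not TT$_0$, respectively. 3. D$\omega$ implies $\omega$, and $\omega$ implies DO. No other implication between $\omega$ and the other conditions holds in general: for every condition $P$ among TT, TT$^{-}$, OP, OP$^{-}$, TT$_0$, TT$_0^{-}$, OP$_0$, OP$_0^{-}$, DDO, DO there is a nonautonomous dynamical system on a nonempty compact metric space satisfying $P$ but not $\omega$; and for every condition $Q$ among D$\omega$, TT, TT$^{-}$, OP, OP$^{-}$, TT$_0$, TT$_0^{-}$, OP$_0$, OP$_0^{-}$, DDO there is a nonautonomous dynamical system on a nonempty compact metric space satisfying $\omega$ but not $Q$.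
   Context: A nonautonomous dynamical system on a compact metric space $X$ is a sequence $f_{1,\infty} = f_1,f_2,f_3,\ldots$ of continuous maps from $X$ to $X$. For a positive integer $n$ put $f_{1,n} = f_n\circ f_{n-1}\circ\cdots\circ f_1$, and put $f_{1,0} = \mathrm{id}_X$. For $A\subset X$, $f_{1,n}^{-1}(A)$ denotes the preimage $(f_{1,n})^{-1}(A)$ of $A$ under the map $f_{1,n}$. The orbit of $x\in X$ is $\operatorname{Orb}_{f_{1,\infty}}(x) = \{x, f_{1,1}(x), f_{1,2}(x),\ldots\}$. The omega-limit set $\omega_{f_{1,\infty}}(x)$ is the set of all limit points of the sequence $(f_{1,n}(x))_{n=1}^\infty$, i.e. the set of all limits of convergent subsequences of this sequence. $\mathbb{N}$ denotes the set of positive integers. *)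

theory Defs
  imports "HOL-Analysis.Analysis"
begin

(* The sequence f_1, f_2, ... is rendered as f :: nat => 'a => 'a whose entry f 0 is never used. *)
definition nonautonomous_system :: "'a metric \<Rightarrow> (nat \<Rightarrow> 'a \<Rightarrow> 'a) \<Rightarrow> bool" where
  "nonautonomous_system m f \<longleftrightarrow>
     compact_space (mtopology_of m) \<and>
     (\<forall>n\<ge>1. continuous_map (mtopology_of m) (mtopology_of m) (f n))"

primrec iterate :: "(nat \<Rightarrow> 'a \<Rightarrow> 'a) \<Rightarrow> nat \<Rightarrow> 'a \<Rightarrow> 'a" where
  "iterate f 0 = id"
| "iterate f (Suc n) = f (Suc n) \<circ> iterate f n"

definition preimage :: "'a metric \<Rightarrow> (nat \<Rightarrow> 'a \<Rightarrow> 'a) \<Rightarrow> nat \<Rightarrow> 'a set \<Rightarrow> 'a set" where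
  "preimage m f n A = {x \<in> mspace m. iterate f n x \<in> A}"

definition orbit :: "(nat \<Rightarrow> 'a \<Rightarrow> 'a) \<Rightarrow> 'a \<Rightarrow> 'a set" where
  "orbit f x = {iterate f n x | n. n \<ge> 0}"

definition omega_limit :: "'a metric \<Rightarrow> (nat \<Rightarrow> 'a \<Rightarrow> 'a) \<Rightarrow> 'a \<Rightarrow> 'a set" where
  "omega_limit m f x =
     {y. \<exists>r :: nat \<Rightarrow> nat. strict_mono r \<and> (\<forall>k. r k \<ge> 1) \<and>
           limitin (mtopology_of m) (\<lambda>k. iterate f (r k) x) y sequentially}"

definition dense_set :: "'a metric \<Rightarrow> 'a set \<Rightarrow> bool" where
  "dense_set m A \<longleftrightarrow> A \<subseteq> mspace m \<and> mtopology_of m closure_of A = mspace m"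

definition nonempty_open :: "'a metric \<Rightarrow> 'a set \<Rightarrow> bool" where
  "nonempty_open m U \<longleftrightarrow> openin (mtopology_of m) U \<and> U \<noteq> {}"

type_synonym 'a condition = "'a metric \<Rightarrow> (nat \<Rightarrow> 'a \<Rightarrow> 'a) \<Rightarrow> bool"

(* A trailing M in a name stands for the superscript minus (preimages instead of images). *)

definition cond_D\<omega> :: "'a condition" where
  "cond_D\<omega> m f \<longleftrightarrow>
     (\<exists>A. dense_set m A \<and> gdelta_in (mtopology_of m) A \<and> (\<forall>x\<in>A. omega_limit m f x = mspace m))"

definition cond_TT :: "'a condition" where
  "cond_TT m f \<longleftrightarrow>
     (\<forall>U V. nonempty_open m U \<and> nonempty_open m V \<longrightarrow> (\<exists>n\<ge>1. iterate f n ` U \<inter> V \<noteq> {}))"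

definition cond_TTM :: "'a condition" where
  "cond_TTM m f \<longleftrightarrow>
     (\<forall>U V. nonempty_open m U \<and> nonempty_open m V \<longrightarrow> (\<exists>n\<ge>1. preimage m f n U \<inter> V \<noteq> {}))"

definition cond_OP :: "'a condition" where
  "cond_OP m f \<longleftrightarrow>
     (\<forall>U. nonempty_open m U \<longrightarrow> dense_set m (\<Union>n\<in>{1..}. iterate f n ` U))"

definition cond_OPM :: "'a condition" where
  "cond_OPM m f \<longleftrightarrow>
     (\<forall>U. nonempty_open m U \<longrightarrow> dense_set m (\<Union>n\<in>{1..}. preimage m f n U))"

definition cond_TT0 :: "'a condition" where
  "cond_TT0 m f \<longleftrightarrow>
     (\<forall>U V. nonempty_open m U \<and> nonempty_open m V \<longrightarrow> (\<exists>n\<ge>0. iterate f n ` U \<inter> V \<noteq> {}))"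

definition cond_TT0M :: "'a condition" where
  "cond_TT0M m f \<longleftrightarrow>
     (\<forall>U V. nonempty_open m U \<and> nonempty_open m V \<longrightarrow> (\<exists>n\<ge>0. preimage m f n U \<inter> V \<noteq> {}))"

definition cond_OP0 :: "'a condition" where
  "cond_OP0 m f \<longleftrightarrow>
     (\<forall>U. nonempty_open m U \<longrightarrow> dense_set m (\<Union>n\<in>{0..}. iterate f n ` U))"

definition cond_OP0M :: "'a condition" where
  "cond_OP0M m f \<longleftrightarrow>
     (\<forall>U. nonempty_open m U \<longrightarrow> dense_set m (\<Union>n\<in>{0..}. preimage m f n U))"

definition cond_DDO :: "'a condition" where
  "cond_DDO m f \<longleftrightarrow>
     (\<exists>A. dense_set m A \<and> gdelta_in (mtopology_of m) A \<and> (\<forall>x\<in>A. dense_set m (orbit f x)))"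

definition cond_DO :: "'a condition" where
  "cond_DO m f \<longleftrightarrow> (\<exists>x\<in>mspace m. dense_set m (orbit f x))"

definition cond_\<omega> :: "'a condition" where
  "cond_\<omega> m f \<longleftrightarrow> (\<exists>x\<in>mspace m. omega_limit m f x = mspace m)"

abbreviation TT_group :: "'a condition set" where
  "TT_group \<equiv> {cond_TT, cond_TTM, cond_OP, cond_OPM}"

abbreviation TT0_group :: "'a condition set" where
  "TT0_group \<equiv> {cond_TT0, cond_TT0M, cond_OP0, cond_OP0M, cond_DDO}"

(* Witnesses are sought among metric spaces whose carrier is a set of reals, with an arbitrary
   metric on it. Since a compact metric space has at most continuum many points, every one of
   them is isometric to a space of this form, so nothing is lost or gained by this choice. *)
definition not_implies :: "real condition \<Rightarrow> real condition \<Rightarrow> bool" where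
  "not_implies P Q \<longleftrightarrow>
     (\<exists>(m :: real metric) f. mspace m \<noteq> {} \<and> nonautonomous_system m f \<and> P m f \<and> \<not> Q m f)"

end

theory Submission
  imports Defs
begin

text \<open>The equivalences within a group only move \<open>f\<^sub>1\<^sub>,\<^sub>n\<close> between image and preimage; the one
  analytic step is the Baire category theorem: with a countable base \<open>\<B>\<close>, the points with a dense
  orbit are those lying in the open set \<open>\<Union>\<^sub>n f\<^sub>1\<^sub>,\<^sub>n\<inverse>(B)\<close> for every nonempty \<open>B \<in> \<B>\<close>, and
  \<open>TT\<^sub>0\<close> makes each of these sets dense. All separating examples live on two or three points.
  Points whose trajectories have merged share all later values, so for \<open>\<omega>\<close> without \<open>TT\<^sub>0\<close> the
  trajectories of two points must stay apart forever while only one of them visits the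
  whole space; this takes three points.\<close>

section \<open>Density and the iterated maps\<close>

lemma nonempty_openD:
  assumes "nonempty_open m U"
  shows "openin (mtopology_of m) U" "U \<noteq> {}" "U \<subseteq> mspace m"
  using assms openin_subset[of "mtopology_of m" U] by (auto simp: nonempty_open_def)

lemma dense_set_iff:
  "dense_set m A \<longleftrightarrow> A \<subseteq> mspace m \<and> (\<forall>V. nonempty_open m V \<longrightarrow> A \<inter> V \<noteq> {})"
  using dense_intersects_open[of "mtopology_of m" A]
  by (simp add: dense_set_def nonempty_open_def)

lemma dense_set_nonempty:
  assumes "dense_set m A" "mspace m \<noteq> {}"
  shows "A \<noteq> {}"
  using assms by (auto simp: dense_set_def)

lemma iterate_continuous:
  assumes "nonautonomous_system m f"
  shows "continuous_map (mtopology_of m) (mtopology_of m) (iterate f n)"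
proof (induction n)
  case (Suc n)
  have "continuous_map (mtopology_of m) (mtopology_of m) (f (Suc n))"
    using assms by (simp add: nonautonomous_system_def)
  with Suc show ?case
    using continuous_map_compose by (simp only: iterate.simps) blast
qed simp

lemma iterate_in_mspace:
  assumes "nonautonomous_system m f" "x \<in> mspace m"
  shows "iterate f n x \<in> mspace m"
  using continuous_map_image_subset_topspace[OF iterate_continuous[OF assms(1), of n]] assms(2)
  by auto

lemma openin_preimage:
  assumes "nonautonomous_system m f" "openin (mtopology_of m) U"
  shows "openin (mtopology_of m) (preimage m f n U)"
  using openin_continuous_map_preimage[OF iterate_continuous[OF assms(1), of n] assms(2)]
  by (simp add: preimage_def)

lemma orbit_subset:
  assumes "nonautonomous_system m f" "x \<in> mspace m"
  shows "orbit f x \<subseteq> mspace m"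
  using iterate_in_mspace[OF assms] by (auto simp: orbit_def)

section \<open>Limit points of trajectories\<close>

text \<open>A subsequence converging to \<open>y\<close> is eventually in \<open>U\<close>, and its
  indices are unbounded. The clause \<open>n \<ge> 1\<close> is what \<open>cond_TT\<close> asks for
  beyond \<open>cond_TT0\<close>.\<close>

lemma omega_limit_frequently:
  assumes "y \<in> omega_limit m f x" "openin (mtopology_of m) U" "y \<in> U"
  shows "\<exists>n\<ge>N. n \<ge> 1 \<and> iterate f n x \<in> U"
proof -
  obtain r where r: "strict_mono r" "\<And>k. r k \<ge> 1"
    and lim: "limitin (mtopology_of m) (\<lambda>k. iterate f (r k) x) y sequentially"
    using assms(1) by (auto simp: omega_limit_def)
  obtain M where M: "\<And>k. k \<ge> M \<Longrightarrow> iterate f (r k) x \<in> U"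
    using lim assms(2,3) unfolding limitin_sequentially by blast
  \<comment> \<open>A strictly increasing \<open>r\<close> satisfies \<open>r k \<ge> k\<close>, so
    the position \<open>max M N\<close> is late enough both for convergence and for the bound
    \<open>N\<close>.\<close>
  have "r (max M N) \<ge> N"
    using seq_suble[OF r(1), of "max M N"] by simp
  with M[of "max M N"] r(2)[of "max M N"] show ?thesis
    by auto
qed

lemma omega_limit_full_imp_dense_orbit:
  assumes "nonautonomous_system m f" "x \<in> mspace m" "omega_limit m f x = mspace m"
  shows "dense_set m (orbit f x)"
  unfolding dense_set_iff
proof (intro conjI allI impI)
  show "orbit f x \<subseteq> mspace m"
    using assms by (intro orbit_subset)
  fix V assume "nonempty_open m V"
  note V = nonempty_openD[OF this]
  then obtain y where "y \<in> V" "y \<in> omega_limit m f x"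
    using assms(3) by auto
  then obtain n where "iterate f n x \<in> V"
    using omega_limit_frequently[OF _ V(1), of y] by blast
  then show "orbit f x \<inter> V \<noteq> {}"
    by (auto simp: orbit_def)
qed

section \<open>A countable base\<close>

text \<open>Total boundedness gives a finite net for each radius \<open>1/(n+1)\<close>; the balls
  of that radius around the net points, taken over all \<open>n\<close>, form a countable
  base.\<close>

lemma compact_metric_second_countable:
  assumes "compact_space (mtopology_of m)"
  shows "second_countable (mtopology_of m)"
proof -
  interpret Metric_space "mspace m" "mdist m"
    by (rule Metric_space_mspace_mdist)
  have top: "mtopology_of m = mtopology"
    by (simp add: mtopology_of_def)
  have "mtotally_bounded (mspace m)"
    using assms by (simp add: top compact_space_eq_mcomplete_mtotally_bounded)
  then have "\<exists>K. finite K \<and> K \<subseteq> mspace m \<and> mspace m \<subseteq> (\<Union>x\<in>K. mball x (inverse (Suc n)))" for n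
    by (auto simp: mtotally_bounded_def)
  then obtain K where K: "\<And>n. finite (K n)" "\<And>n. K n \<subseteq> mspace m"
    "\<And>n. mspace m \<subseteq> (\<Union>x\<in>K n. mball x (inverse (Suc n)))"
    by metis
  define \<B> where "\<B> = (\<Union>n. (\<lambda>x. mball x (inverse (Suc n))) ` K n)"
  have "countable \<B>"
    using K(1) by (auto simp: \<B>_def intro: countable_finite)
  moreover have "\<forall>V\<in>\<B>. openin mtopology V"
    by (auto simp: \<B>_def)
  moreover have "\<exists>V\<in>\<B>. x \<in> V \<and> V \<subseteq> U" if "openin mtopology U" "x \<in> U" for U x
  proof -
    obtain e where e: "e > 0" "mball x e \<subseteq> U" and x: "x \<in> mspace m"
      using \<open>openin mtopology U\<close> \<open>x \<in> U\<close> unfolding openin_mtopology by blast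
    \<comment> \<open>Half of \<open>e\<close>, because a point of the net ball is reached from
      \<open>x\<close> in two steps, through the centre \<open>y\<close>, each shorter than the net
      radius.\<close>
    obtain n where n: "inverse (Suc n) < e / 2"
      using reals_Archimedean[of "e / 2"] e(1) by auto
    obtain y where y: "y \<in> K n" "x \<in> mball y (inverse (Suc n))"
      using K(3)[of n] x by blast
    have "mball y (inverse (Suc n)) \<subseteq> mball x e"
    proof
      fix z assume z: "z \<in> mball y (inverse (Suc n))"
      have "mdist m x z \<le> mdist m y x + mdist m y z"
        using triangle[of x y z] y z x by (simp add: commute)
      with n y z show "z \<in> mball x e"
        by auto
    qed
    with y e show ?thesis
      by (auto simp: \<B>_def)
  qed
  ultimately show ?thesis
    unfolding top second_countable_def by (intro exI[of _ \<B>]) simp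
qed

section \<open>Images, preimages and unions\<close>

text \<open>Both sides speak of a point of \<open>U\<close> that is sent into \<open>V\<close>, so
  passing to preimages only swaps the roles of two universally quantified sets. Since
  \<open>preimage\<close> keeps only carrier points, \<open>U\<close> has to lie in the
  carrier.\<close>

lemma TT_iff_TTM: "cond_TT m f \<longleftrightarrow> cond_TTM m f"
proof -
  have "iterate f n ` U \<inter> V \<noteq> {} \<longleftrightarrow> preimage m f n V \<inter> U \<noteq> {}"
    if "nonempty_open m U" for n U V
    using nonempty_openD(3)[OF that] by (auto simp: preimage_def)
  then show ?thesis
    unfolding cond_TT_def cond_TTM_def by metis
qed

lemma TT0_iff_TT0M: "cond_TT0 m f \<longleftrightarrow> cond_TT0M m f"
proof -
  have "iterate f n ` U \<inter> V \<noteq> {} \<longleftrightarrow> preimage m f n V \<inter> U \<noteq> {}"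
    if "nonempty_open m U" for n U V
    using nonempty_openD(3)[OF that] by (auto simp: preimage_def)
  then show ?thesis
    unfolding cond_TT0_def cond_TT0M_def by metis
qed

text \<open>The index set \<open>I\<close> is left open so that \<open>{1..}\<close> and
  \<open>{0..}\<close> are treated at once.\<close>

lemma dense_image_Union_iff:
  assumes "nonautonomous_system m f" "nonempty_open m U"
  shows "dense_set m (\<Union>n\<in>I. iterate f n ` U) \<longleftrightarrow>
    (\<forall>V. nonempty_open m V \<longrightarrow> (\<exists>n\<in>I. iterate f n ` U \<inter> V \<noteq> {}))"
proof -
  have "(\<Union>n\<in>I. iterate f n ` U) \<subseteq> mspace m"
    using iterate_in_mspace[OF assms(1)] nonempty_openD(3)[OF assms(2)] by blast
  then show ?thesis
    unfolding dense_set_iff by blast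
qed

lemma dense_preimage_Union_iff:
  "dense_set m (\<Union>n\<in>I. preimage m f n U) \<longleftrightarrow>
    (\<forall>V. nonempty_open m V \<longrightarrow> (\<exists>n\<in>I. preimage m f n U \<inter> V \<noteq> {}))"
proof -
  have "(\<Union>n\<in>I. preimage m f n U) \<subseteq> mspace m"
    by (auto simp: preimage_def)
  then show ?thesis
    unfolding dense_set_iff by blast
qed

lemma TT_iff_OP:
  assumes "nonautonomous_system m f"
  shows "cond_TT m f \<longleftrightarrow> cond_OP m f"
  unfolding cond_TT_def cond_OP_def by (auto simp: dense_image_Union_iff[OF assms] Bex_def)

lemma TT0_iff_OP0:
  assumes "nonautonomous_system m f"
  shows "cond_TT0 m f \<longleftrightarrow> cond_OP0 m f"
  unfolding cond_TT0_def cond_OP0_def by (auto simp: dense_image_Union_iff[OF assms] Bex_def)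

lemma TTM_iff_OPM: "cond_TTM m f \<longleftrightarrow> cond_OPM m f"
  unfolding cond_TTM_def cond_OPM_def dense_preimage_Union_iff by (auto simp: Bex_def)

lemma TT0M_iff_OP0M: "cond_TT0M m f \<longleftrightarrow> cond_OP0M m f"
  unfolding cond_TT0M_def cond_OP0M_def dense_preimage_Union_iff by (auto simp: Bex_def)

section \<open>Dense orbits and Baire category\<close>

text \<open>Some point of \<open>A\<close> lies in \<open>V\<close>, and its dense orbit visits
  \<open>U\<close>, possibly already at time 0.\<close>

lemma DDO_imp_TT0M:
  assumes "cond_DDO m f"
  shows "cond_TT0M m f"
  unfolding cond_TT0M_def
proof (intro allI impI, elim conjE)
  fix U V assume U: "nonempty_open m U" and V: "nonempty_open m V"
  obtain A where "dense_set m A" and orb: "\<And>x. x \<in> A \<Longrightarrow> dense_set m (orbit f x)"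
    using assms by (auto simp: cond_DDO_def)
  then obtain x where x: "x \<in> A" "x \<in> V"
    using V unfolding dense_set_iff by blast
  then obtain n where "iterate f n x \<in> U"
    using orb[of x] U by (auto simp: dense_set_iff orbit_def)
  with x nonempty_openD(3)[OF V] show "\<exists>n\<ge>0. preimage m f n U \<inter> V \<noteq> {}"
    by (auto simp: preimage_def)
qed

lemma OP0M_imp_DDO:
  assumes sys: "nonautonomous_system m f" and "cond_OP0M m f"
  shows "cond_DDO m f"
proof -
  let ?X = "mtopology_of m"
  have cpt: "compact_space ?X"
    using sys by (simp add: nonautonomous_system_def)
  obtain \<B> where \<B>: "countable \<B>" "\<And>V. V \<in> \<B> \<Longrightarrow> openin ?X V"
    "\<And>U x. openin ?X U \<Longrightarrow> x \<in> U \<Longrightarrow> \<exists>V\<in>\<B>. x \<in> V \<and> V \<subseteq> U"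
    using compact_metric_second_countable[OF cpt] unfolding second_countable_def by metis
  \<comment> \<open>\<open>G U\<close> consists of the points whose orbit, time 0 included, meets
    \<open>U\<close>; it is open by continuity and, for nonempty open \<open>U\<close>, dense by
    \<open>cond_OP0M\<close>.\<close>
  define G where "G U = (\<Union>n\<in>{0..}. preimage m f n U)" for U
  \<comment> \<open>Inserting the whole space avoids the empty intersection, which would be \<open>UNIV\<close>.\<close>
  define \<G> where "\<G> = insert (mspace m) (G ` (\<B> - {{}}))"
  have "countable \<G>"
    using \<B>(1) by (simp add: \<G>_def)
  have G_open: "openin ?X T" if "T \<in> \<G>" for T
    using that \<B>(2) openin_preimage[OF sys] openin_topspace[of ?X] by (auto simp: \<G>_def G_def)
  \<comment> \<open>The empty set was removed from \<open>\<B>\<close> because \<open>G {}\<close>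
    is empty, which would spoil density.\<close>
  have G_dense: "dense_set m T" if "T \<in> \<G>" for T
    using that \<open>cond_OP0M m f\<close> \<B>(2) closure_of_topspace[of ?X]
    by (auto simp: \<G>_def G_def cond_OP0M_def nonempty_open_def dense_set_def[of m "mspace m"])
  \<comment> \<open>Compactness yields the completeness that Baire's theorem requires.\<close>
  have "completely_metrizable_space ?X"
  proof -
    interpret Metric_space "mspace m" "mdist m"
      by (rule Metric_space_mspace_mdist)
    have "mcomplete"
      using cpt by (simp add: mtopology_of_def compact_space_eq_mcomplete_mtotally_bounded)
    then show ?thesis
      by (simp add: mtopology_of_def completely_metrizable_space_mtopology)
  qed
  then have "?X closure_of \<Inter>\<G> = topspace ?X"
    using \<open>countable \<G>\<close> G_open G_dense by (intro Baire_category) (auto simp: dense_set_def)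
  moreover have "\<Inter>\<G> \<subseteq> mspace m"
    by (auto simp: \<G>_def)
  ultimately have "dense_set m (\<Inter>\<G>)"
    by (simp add: dense_set_def)
  moreover have "gdelta_in ?X (\<Inter>\<G>)"
    using \<open>countable \<G>\<close> G_open
    by (intro gdelta_in_Inter) (auto simp: open_imp_gdelta_in, simp add: \<G>_def)
  moreover have "dense_set m (orbit f x)" if x: "x \<in> \<Inter>\<G>" for x
    unfolding dense_set_iff
  proof (intro conjI allI impI)
    show "orbit f x \<subseteq> mspace m"
      using x \<open>\<Inter>\<G> \<subseteq> mspace m\<close> by (intro orbit_subset[OF sys]) auto
    fix V assume "nonempty_open m V"
    \<comment> \<open>Every nonempty open set contains a nonempty base set, so visiting all of the
      countably many base sets already makes the orbit dense.\<close>
    then obtain B where B: "B \<in> \<B>" "B \<noteq> {}" "B \<subseteq> V"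
      using \<B>(3) unfolding nonempty_open_def by blast
    then have "x \<in> G B"
      using x by (auto simp: \<G>_def)
    then show "orbit f x \<inter> V \<noteq> {}"
      using B(3) by (auto simp: G_def preimage_def orbit_def)
  qed
  ultimately show ?thesis
    unfolding cond_DDO_def by blast
qed

section \<open>Implications between the groups\<close>

text \<open>\<open>cond_TT\<close> serves as representative of its group, so that implications
  between groups need a proof for representatives only.\<close>

lemma TT_group_iff:
  assumes "nonautonomous_system m f" "P \<in> TT_group"
  shows "P m f \<longleftrightarrow> cond_TT m f"
proof -
  have *: "cond_TTM m f \<longleftrightarrow> cond_TT m f" "cond_OP m f \<longleftrightarrow> cond_TT m f"
    "cond_OPM m f \<longleftrightarrow> cond_TT m f"
    using TT_iff_TTM[of m f] TT_iff_OP[OF assms(1)] TTM_iff_OPM[of m f] by argo+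
  show ?thesis
    using assms(2) by (elim insertE emptyE) (simp_all only: *)
qed

text \<open>\<open>cond_DDO\<close> joins the group through the loop from \<open>cond_OP0M\<close>
  to \<open>cond_DDO\<close> to \<open>cond_TT0M\<close> and back.\<close>

lemma TT0_group_iff:
  assumes "nonautonomous_system m f" "P \<in> TT0_group"
  shows "P m f \<longleftrightarrow> cond_TT0 m f"
proof -
  have *: "cond_TT0M m f \<longleftrightarrow> cond_TT0 m f" "cond_OP0 m f \<longleftrightarrow> cond_TT0 m f"
    "cond_OP0M m f \<longleftrightarrow> cond_TT0 m f" "cond_DDO m f \<longleftrightarrow> cond_TT0 m f"
    using TT0_iff_TT0M[of m f] TT0_iff_OP0[OF assms(1)] TT0M_iff_OP0M[of m f]
      DDO_imp_TT0M[of m f] OP0M_imp_DDO[OF assms(1)] by argo+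
  show ?thesis
    using assms(2) by (elim insertE emptyE) (simp_all only: *)
qed

text \<open>A point of the dense set inside \<open>V\<close> has every point of \<open>U\<close> as
  a limit point, hence enters \<open>U\<close> at a positive time.\<close>

lemma D\<omega>_imp_TT:
  assumes "cond_D\<omega> m f"
  shows "cond_TT m f"
  unfolding TT_iff_TTM cond_TTM_def
proof (intro allI impI, elim conjE)
  fix U V assume U: "nonempty_open m U" and V: "nonempty_open m V"
  obtain A where "dense_set m A" and om: "\<And>x. x \<in> A \<Longrightarrow> omega_limit m f x = mspace m"
    using assms by (auto simp: cond_D\<omega>_def)
  then obtain x where x: "x \<in> A" "x \<in> V"
    using V unfolding dense_set_iff by blast
  obtain y where "y \<in> U" "y \<in> omega_limit m f x"
    using om[OF x(1)] nonempty_openD[OF U] by auto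
  then obtain n where "n \<ge> 1" "iterate f n x \<in> U"
    using omega_limit_frequently[OF _ nonempty_openD(1)[OF U], of y] by blast
  with x nonempty_openD(3)[OF V] show "\<exists>n\<ge>1. preimage m f n U \<inter> V \<noteq> {}"
    by (auto simp: preimage_def)
qed

lemma TT_imp_TT0: "cond_TT m f \<Longrightarrow> cond_TT0 m f"
  unfolding cond_TT_def cond_TT0_def by blast

text \<open>By way of \<open>cond_DDO\<close>: in a nonempty space a dense set has an element, and
  any element serves.\<close>

lemma TT0_imp_DO:
  assumes "nonautonomous_system m f" "mspace m \<noteq> {}" "cond_TT0 m f"
  shows "cond_DO m f"
proof -
  have "cond_DDO m f"
    using TT0_group_iff[OF assms(1), of cond_DDO] assms(3) by simp
  then obtain A where A: "dense_set m A" "\<And>x. x \<in> A \<Longrightarrow> dense_set m (orbit f x)"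
    by (auto simp: cond_DDO_def)
  moreover obtain x where "x \<in> A"
    using dense_set_nonempty[OF A(1) assms(2)] by blast
  ultimately show ?thesis
    unfolding cond_DO_def dense_set_def by blast
qed

lemma D\<omega>_imp_\<omega>:
  assumes "mspace m \<noteq> {}" "cond_D\<omega> m f"
  shows "cond_\<omega> m f"
proof -
  obtain A where A: "dense_set m A" "\<And>x. x \<in> A \<Longrightarrow> omega_limit m f x = mspace m"
    using assms(2) by (auto simp: cond_D\<omega>_def)
  moreover obtain x where "x \<in> A"
    using dense_set_nonempty[OF A(1) assms(1)] by blast
  ultimately show ?thesis
    unfolding cond_\<omega>_def dense_set_def by blast
qed

lemma \<omega>_imp_DO:
  assumes "nonautonomous_system m f" "cond_\<omega> m f"
  shows "cond_DO m f"
proof -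
  obtain x where "x \<in> mspace m" "omega_limit m f x = mspace m"
    using assms(2) by (auto simp: cond_\<omega>_def)
  then show ?thesis
    using omega_limit_full_imp_dense_orbit[OF assms(1)] by (auto simp: cond_DO_def)
qed

subsection \<open>Systems on finite spaces\<close>

abbreviation points :: "real set \<Rightarrow> real metric" where
  "points S \<equiv> submetric euclidean_metric S"

text \<open>A finite Hausdorff space is discrete. Hence every self-map is continuous and singletons
  are open, which turns all conditions into statements about single points.\<close>

lemma mtopology_of_points:
  assumes "finite S"
  shows "mtopology_of (points S) = discrete_topology S"
  using assms
  by (intro finite_topspace_imp_discrete_topology)
    (auto simp: mtopology_of_submetric intro: Hausdorff_space_subtopology)

lemma nonautonomous_system_points:
  assumes "finite S" "\<And>n x. x \<in> S \<Longrightarrow> f n x \<in> S"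
  shows "nonautonomous_system (points S) f"
  using assms
  by (auto simp: nonautonomous_system_def mtopology_of_points compact_space_discrete_topology)

lemma nonempty_open_points:
  assumes "finite S"
  shows "nonempty_open (points S) U \<longleftrightarrow> U \<subseteq> S \<and> U \<noteq> {}"
  using assms by (simp add: nonempty_open_def mtopology_of_points)

lemma TT_points:
  assumes "finite S"
  shows "cond_TT (points S) f \<longleftrightarrow> (\<forall>x\<in>S. \<forall>y\<in>S. \<exists>n\<ge>1. iterate f n x = y)"
proof
  assume L: "cond_TT (points S) f"
  have "\<exists>n\<ge>1. iterate f n ` {x} \<inter> {y} \<noteq> {}" if "x \<in> S" "y \<in> S" for x y
    using L[unfolded cond_TT_def, rule_format, of "{x}" "{y}"] that assms
    by (simp only: nonempty_open_points) blast
  then show "\<forall>x\<in>S. \<forall>y\<in>S. \<exists>n\<ge>1. iterate f n x = y"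
    by auto
next
  assume R: "\<forall>x\<in>S. \<forall>y\<in>S. \<exists>n\<ge>1. iterate f n x = y"
  show "cond_TT (points S) f"
    unfolding cond_TT_def nonempty_open_points[OF assms]
  proof (intro allI impI)
    fix U V assume "(U \<subseteq> S \<and> U \<noteq> {}) \<and> (V \<subseteq> S \<and> V \<noteq> {})"
    then obtain x y where "x \<in> U" "y \<in> V" "x \<in> S" "y \<in> S"
      by blast
    moreover from this R obtain n where "n \<ge> 1" "iterate f n x = y"
      by metis
    ultimately show "\<exists>n\<ge>1. iterate f n ` U \<inter> V \<noteq> {}"
      by (intro exI[of _ n]) auto
  qed
qed

lemma TT0_points:
  assumes "finite S"
  shows "cond_TT0 (points S) f \<longleftrightarrow> (\<forall>x\<in>S. \<forall>y\<in>S. \<exists>n. iterate f n x = y)"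
proof
  assume L: "cond_TT0 (points S) f"
  have "\<exists>n\<ge>0. iterate f n ` {x} \<inter> {y} \<noteq> {}" if "x \<in> S" "y \<in> S" for x y
    using L[unfolded cond_TT0_def, rule_format, of "{x}" "{y}"] that assms
    by (simp only: nonempty_open_points) blast
  then show "\<forall>x\<in>S. \<forall>y\<in>S. \<exists>n. iterate f n x = y"
    by auto
next
  assume R: "\<forall>x\<in>S. \<forall>y\<in>S. \<exists>n. iterate f n x = y"
  show "cond_TT0 (points S) f"
    unfolding cond_TT0_def nonempty_open_points[OF assms]
  proof (intro allI impI)
    fix U V assume "(U \<subseteq> S \<and> U \<noteq> {}) \<and> (V \<subseteq> S \<and> V \<noteq> {})"
    then obtain x y where "x \<in> U" "y \<in> V" "x \<in> S" "y \<in> S"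
      by blast
    moreover from this R obtain n where "iterate f n x = y"
      by metis
    ultimately show "\<exists>n\<ge>0. iterate f n ` U \<inter> V \<noteq> {}"
      by (intro exI[of _ n]) auto
  qed
qed

lemma DO_points:
  assumes "finite S"
  shows "cond_DO (points S) f \<longleftrightarrow> (\<exists>x\<in>S. orbit f x = S)"
  using assms
  by (auto simp: cond_DO_def dense_set_def mtopology_of_points discrete_topology_closure_of)

text \<open>In a discrete space a convergent sequence is eventually constant, so the limit points
  are exactly the values taken infinitely often.\<close>

lemma \<omega>_points:
  assumes "finite S"
  shows "cond_\<omega> (points S) f \<longleftrightarrow> (\<exists>x\<in>S. \<forall>y\<in>S. \<exists>\<^sub>\<infinity>n. iterate f n x = y)"
proof -
  have "omega_limit (points S) f x = {y\<in>S. \<exists>\<^sub>\<infinity>n. iterate f n x = y}" for x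
  proof (intro equalityI subsetI)
    fix y assume y: "y \<in> omega_limit (points S) f x"
    then have "y \<in> S"
      using assms by (auto simp: omega_limit_def limitin_def mtopology_of_points)
    then have "\<exists>n\<ge>N. iterate f n x = y" for N
      using omega_limit_frequently[OF y, of "{y}" N] assms by (auto simp: mtopology_of_points)
    with \<open>y \<in> S\<close> show "y \<in> {y\<in>S. \<exists>\<^sub>\<infinity>n. iterate f n x = y}"
      by (simp add: INFM_nat_le)
  next
    fix y assume y: "y \<in> {y\<in>S. \<exists>\<^sub>\<infinity>n. iterate f n x = y}"
    \<comment> \<open>Enumerating \<open>I\<close> in increasing order gives a subsequence on which
      the trajectory is constantly \<open>y\<close>; time 0 is left out because
      \<open>omega_limit\<close> uses positive indices only.\<close>
    define I where "I = {n. n \<ge> 1 \<and> iterate f n x = y}"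
    have "\<exists>n\<ge>N. n \<in> I" for N
    proof -
      obtain n where "n \<ge> max N 1" "iterate f n x = y"
        using y unfolding INFM_nat_le by blast
      then show ?thesis
        by (auto simp: I_def)
    qed
    then have "infinite I"
      by (auto simp: infinite_nat_iff_unbounded_le)
    have mem: "enumerate I k \<in> I" for k
      using enumerate_in_set[OF \<open>infinite I\<close>] .
    have "limitin (mtopology_of (points S)) (\<lambda>k. iterate f (enumerate I k) x) y sequentially"
      using mem y by (intro limitin_eventually) (auto simp: I_def)
    then show "y \<in> omega_limit (points S) f x"
      using mem strict_mono_enumerate[OF \<open>infinite I\<close>] by (auto simp: omega_limit_def I_def)
  qed
  then show ?thesis
    unfolding cond_\<omega>_def by auto
qed

lemma not_implies_pointsI:
  assumes "finite S" "S \<noteq> {}" "\<And>n x. x \<in> S \<Longrightarrow> f n x \<in> S"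
    and "P (points S) f" "\<not> Q (points S) f"
  shows "not_implies P Q"
  unfolding not_implies_def
  using assms nonautonomous_system_points[of S f] by (intro exI[of _ "points S"] exI[of _ f]) auto

section \<open>Separating examples\<close>

text \<open>The identity takes each point to itself at time 1 and the swap takes it to the other
  point at time 2, which secures \<open>cond_TT\<close>. From time 3 on everything sits at 0, so 1
  is never a limit point.\<close>

lemma TT_not_implies_\<omega>: "not_implies cond_TT cond_\<omega>"
proof (rule not_implies_pointsI)
  let ?S = "{0, 1} :: real set"
  define f :: "nat \<Rightarrow> real \<Rightarrow> real"
    where "f n x = (if n = 1 then x else if n = 2 then 1 - x else 0)" for n x
  show "finite ?S" "?S \<noteq> {}"
    by auto
  show "f n x \<in> ?S" if "x \<in> ?S" for n x
    using that by (auto simp: f_def)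
  have it: "iterate f 1 x = x" "iterate f 2 x = 1 - x" for x
    by (simp_all add: f_def numeral_2_eq_2)
  have late: "iterate f n x = 0" if "n \<ge> 3" for n x
    using that by (cases n) (auto simp: f_def)
  have "\<exists>n\<ge>1. iterate f n x = y" if "x \<in> ?S" "y \<in> ?S" for x y
  proof (cases "x = y")
    case True
    then show ?thesis
      using it(1) by blast
  next
    case False
    then have "iterate f 2 x = y"
      using that it(2)[of x] by auto
    then show ?thesis
      by (intro exI[of _ 2]) simp
  qed
  then show "cond_TT (points ?S) f"
    by (subst TT_points) auto
  have "\<not> (\<exists>\<^sub>\<infinity>n. iterate f n x = 1)" for x
    using late unfolding INFM_nat_le by force
  then show "\<not> cond_\<omega> (points ?S) f"
    by (subst \<omega>_points) auto
qed

text \<open>One swap, then rest: each point meets itself only at time 0 and the other point at every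
  later time.\<close>

lemma TT0_not_implies_TT: "not_implies cond_TT0 cond_TT"
proof (rule not_implies_pointsI)
  let ?S = "{0, 1} :: real set"
  define f :: "nat \<Rightarrow> real \<Rightarrow> real" where "f n x = (if n = 1 then 1 - x else x)" for n x
  show "finite ?S" "?S \<noteq> {}"
    by auto
  show "f n x \<in> ?S" if "x \<in> ?S" for n x
    using that by (auto simp: f_def)
  have "iterate f (Suc n) x = 1 - x" for n x
    by (induction n) (auto simp: f_def)
  then have it: "iterate f n x = 1 - x" if "n \<ge> 1" for n x
    using that by (cases n) auto
  have "\<exists>n. iterate f n x = y" if "x \<in> ?S" "y \<in> ?S" for x y
  proof (cases "x = y")
    case True
    then show ?thesis
      by (intro exI[of _ 0]) simp
  next
    case False
    then have "iterate f 1 x = y"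
      using that it[of 1 x] by auto
    then show ?thesis ..
  qed
  then show "cond_TT0 (points ?S) f"
    by (subst TT0_points) auto
  show "\<not> cond_TT (points ?S) f"
    by (subst TT_points) (auto simp: it)
qed

text \<open>All points collapse to 1 at once: the orbit of 0 is the whole space, while 1 never
  reaches 0.\<close>

lemma DO_not_implies_TT0: "not_implies cond_DO cond_TT0"
proof (rule not_implies_pointsI)
  let ?S = "{0, 1} :: real set"
  define f :: "nat \<Rightarrow> real \<Rightarrow> real" where "f n x = 1" for n x
  show "finite ?S" "?S \<noteq> {}"
    by auto
  show "f n x \<in> ?S" if "x \<in> ?S" for n x
    by (simp add: f_def)
  have it: "iterate f n x = (if n = 0 then x else 1)" for n x
    by (cases n) (auto simp: f_def)
  have "orbit f 0 = ?S"
    by (auto simp: orbit_def it)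
  then show "cond_DO (points ?S) f"
    by (subst DO_points) auto
  show "\<not> cond_TT0 (points ?S) f"
    by (subst TT0_points) (auto simp: it)
qed

lemma \<omega>_not_implies_TT0: "not_implies cond_\<omega> cond_TT0"
proof (rule not_implies_pointsI)
  let ?S = "{0, 1, 2} :: real set"
  \<comment> \<open>The pair of trajectories of 0 and 1 runs through (0,1), (1,2), (2,1) periodically.\<close>
  define f :: "nat \<Rightarrow> real \<Rightarrow> real"
    where "f n x = (if n mod 3 = 1 then min (x + 1) 2
      else if n mod 3 = 2 then (if x = 0 then 0 else 3 - x) else 2 - x)" for n x
  show "finite ?S" "?S \<noteq> {}"
    by auto
  show "f n x \<in> ?S" if "x \<in> ?S" for n x
    using that by (auto simp: f_def)
  have m3: "n mod 3 = 0 \<or> n mod 3 = 1 \<or> n mod 3 = 2" for n :: nat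
    by auto
  \<comment> \<open>The map applied after time \<open>n\<close> is \<open>f (Suc n)\<close>: for
    residues 0, 1, 2 of \<open>n\<close> it is the capped increment, the exchange of 1 and 2, and
    the reflection \<open>2 - x\<close>.\<close>
  have it0: "iterate f n 0 = real (n mod 3)" for n
  proof (induction n)
    case (Suc n)
    then show ?case
      using m3[of n] by (auto simp: f_def mod_Suc)
  qed simp
  have it1: "iterate f n 1 = (if n mod 3 = 1 then 2 else 1)" for n
  proof (induction n)
    case (Suc n)
    then show ?case
      using m3[of n] by (auto simp: f_def mod_Suc)
  qed simp
  have "\<exists>\<^sub>\<infinity>n. iterate f n 0 = y" if "y \<in> ?S" for y
  proof -
    obtain j :: nat where j: "y = real j" "j < 3"
      using \<open>y \<in> ?S\<close> by (auto intro: that[of 0] that[of 1] that[of 2])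
    then have "iterate f (3 * N + j) 0 = y" for N
      by (simp add: it0)
    moreover have "3 * N + j \<ge> N" for N
      by simp
    ultimately show ?thesis
      unfolding INFM_nat_le by blast
  qed
  then show "cond_\<omega> (points ?S) f"
    by (subst \<omega>_points) auto
  \<comment> \<open>The open sets \<open>{1}\<close> and \<open>{0}\<close> therefore refute
    \<open>cond_TT0\<close>.\<close>
  have "iterate f n 1 \<noteq> 0" for n
    by (simp add: it1)
  then show "\<not> cond_TT0 (points ?S) f"
    by (subst TT0_points) auto
qed

section \<open>Transfer of the examples\<close>

text \<open>A counterexample survives weakening of the premise and strengthening of the conclusion;
  this is how four examples settle all non-implications.\<close>

lemma not_implies_mono:
  assumes "not_implies P Q"
    and "\<And>m f. mspace m \<noteq> {} \<Longrightarrow> nonautonomous_system m f \<Longrightarrow> P m f \<Longrightarrow> P' m f"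
    and "\<And>m f. mspace m \<noteq> {} \<Longrightarrow> nonautonomous_system m f \<Longrightarrow> Q' m f \<Longrightarrow> Q m f"
  shows "not_implies P' Q'"
proof -
  obtain m :: "real metric" and f
    where "mspace m \<noteq> {}" "nonautonomous_system m f" "P m f" "\<not> Q m f"
    using assms(1) unfolding not_implies_def by blast
  moreover from this have "P' m f" "\<not> Q' m f"
    using assms(2,3)[of m f] by auto
  ultimately show ?thesis
    unfolding not_implies_def by blast
qed

theorem theorem5:
  shows
    "(\<forall>(m :: 'a metric) f. mspace m \<noteq> {} \<and> nonautonomous_system m f \<longrightarrow>
        (\<forall>P\<in>TT_group. \<forall>Q\<in>TT_group. P m f \<longleftrightarrow> Q m f) \<and>
        (\<forall>P\<in>TT0_group. \<forall>Q\<in>TT0_group. P m f \<longleftrightarrow> Q m f))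
     \<and>
     (\<forall>(m :: 'a metric) f. mspace m \<noteq> {} \<and> nonautonomous_system m f \<longrightarrow>
        (\<forall>P\<in>TT_group. cond_D\<omega> m f \<longrightarrow> P m f) \<and>
        (\<forall>P\<in>TT_group. \<forall>Q\<in>TT0_group. P m f \<longrightarrow> Q m f) \<and>
        (\<forall>Q\<in>TT0_group. Q m f \<longrightarrow> cond_DO m f)) \<and>
     (\<forall>P\<in>TT_group. not_implies P cond_D\<omega>) \<and>
     (\<forall>P\<in>TT_group. \<forall>Q\<in>TT0_group. not_implies Q P) \<and>
     (\<forall>Q\<in>TT0_group. not_implies cond_DO Q)
     \<and>
     (\<forall>(m :: 'a metric) f. mspace m \<noteq> {} \<and> nonautonomous_system m f \<longrightarrow>
        (cond_D\<omega> m f \<longrightarrow> cond_\<omega> m f) \<and> (cond_\<omega> m f \<longrightarrow> cond_DO m f)) \<and>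
     (\<forall>P \<in> TT_group \<union> TT0_group \<union> {cond_DO}. not_implies P cond_\<omega>) \<and>
     (\<forall>Q \<in> {cond_D\<omega>} \<union> TT_group \<union> TT0_group. not_implies cond_\<omega> Q)"
proof (intro conjI)
  show "\<forall>(m :: 'a metric) f. mspace m \<noteq> {} \<and> nonautonomous_system m f \<longrightarrow>
      (\<forall>P\<in>TT_group. \<forall>Q\<in>TT_group. P m f \<longleftrightarrow> Q m f) \<and>
      (\<forall>P\<in>TT0_group. \<forall>Q\<in>TT0_group. P m f \<longleftrightarrow> Q m f)"
  proof (intro allI impI, elim conjE)
    fix m :: "'a metric" and f
    assume "nonautonomous_system m f"
    note TT = TT_group_iff[OF this] and TT0 = TT0_group_iff[OF this]
    have "P m f \<longleftrightarrow> Q m f" if "P \<in> TT_group" "Q \<in> TT_group" for P Q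
      unfolding TT[OF that(1)] TT[OF that(2)] ..
    moreover have "P m f \<longleftrightarrow> Q m f" if "P \<in> TT0_group" "Q \<in> TT0_group" for P Q
      unfolding TT0[OF that(1)] TT0[OF that(2)] ..
    ultimately show "(\<forall>P\<in>TT_group. \<forall>Q\<in>TT_group. P m f \<longleftrightarrow> Q m f) \<and>
        (\<forall>P\<in>TT0_group. \<forall>Q\<in>TT0_group. P m f \<longleftrightarrow> Q m f)"
      by (intro conjI ballI)
  qed
  show "\<forall>(m :: 'a metric) f. mspace m \<noteq> {} \<and> nonautonomous_system m f \<longrightarrow>
      (\<forall>P\<in>TT_group. cond_D\<omega> m f \<longrightarrow> P m f) \<and>
      (\<forall>P\<in>TT_group. \<forall>Q\<in>TT0_group. P m f \<longrightarrow> Q m f) \<and>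
      (\<forall>Q\<in>TT0_group. Q m f \<longrightarrow> cond_DO m f)"
  proof (intro allI impI, elim conjE)
    fix m :: "'a metric" and f
    assume ne: "mspace m \<noteq> {}" and sys: "nonautonomous_system m f"
    note TT = TT_group_iff[OF sys] and TT0 = TT0_group_iff[OF sys]
    have "P m f" if "P \<in> TT_group" "cond_D\<omega> m f" for P
      unfolding TT[OF that(1)] using that(2) by (rule D\<omega>_imp_TT)
    moreover have "Q m f" if "P \<in> TT_group" "Q \<in> TT0_group" "P m f" for P Q
      using that(3) TT_imp_TT0 unfolding TT[OF that(1)] TT0[OF that(2)] by blast
    moreover have "cond_DO m f" if "Q \<in> TT0_group" "Q m f" for Q
      using that(2) TT0_imp_DO[OF sys ne] unfolding TT0[OF that(1)] by blast
    ultimately show "(\<forall>P\<in>TT_group. cond_D\<omega> m f \<longrightarrow> P m f) \<and>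
        (\<forall>P\<in>TT_group. \<forall>Q\<in>TT0_group. P m f \<longrightarrow> Q m f) \<and>
        (\<forall>Q\<in>TT0_group. Q m f \<longrightarrow> cond_DO m f)"
      by (intro conjI ballI impI)
  qed
  \<comment> \<open>Since \<open>cond_D\<omega>\<close> implies \<open>cond_\<omega>\<close>, the
    example without \<open>cond_\<omega>\<close> also lacks \<open>cond_D\<omega>\<close>.\<close>
  show "\<forall>P\<in>TT_group. not_implies P cond_D\<omega>"
    by (intro ballI, rule not_implies_mono[OF TT_not_implies_\<omega>])
      (erule (2) iffD2[OF TT_group_iff], rule D\<omega>_imp_\<omega>)
  show "\<forall>P\<in>TT_group. \<forall>Q\<in>TT0_group. not_implies Q P"
    by (intro ballI, rule not_implies_mono[OF TT0_not_implies_TT])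
      (erule (2) iffD2[OF TT0_group_iff], erule (2) iffD1[OF TT_group_iff])
  show "\<forall>Q\<in>TT0_group. not_implies cond_DO Q"
    by (intro ballI, rule not_implies_mono[OF DO_not_implies_TT0])
      (assumption, erule (2) iffD1[OF TT0_group_iff])
  show "\<forall>(m :: 'a metric) f. mspace m \<noteq> {} \<and> nonautonomous_system m f \<longrightarrow>
      (cond_D\<omega> m f \<longrightarrow> cond_\<omega> m f) \<and> (cond_\<omega> m f \<longrightarrow> cond_DO m f)"
    by (intro allI impI conjI; elim conjE)
      (rule D\<omega>_imp_\<omega>, assumption+, rule \<omega>_imp_DO, assumption+)
  show "\<forall>P \<in> TT_group \<union> TT0_group \<union> {cond_DO}. not_implies P cond_\<omega>"
  proof
    fix P :: "real condition"
    assume "P \<in> TT_group \<union> TT0_group \<union> {cond_DO}"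
    then consider "P \<in> TT_group" | "P \<in> TT0_group" | "P = cond_DO"
      by blast
    \<comment> \<open>Every listed \<open>P\<close> follows from \<open>cond_TT\<close>, so the
      example for \<open>cond_TT\<close> covers them all.\<close>
    then have "P m f"
      if ne: "mspace m \<noteq> {}" and sys: "nonautonomous_system m f" and TT: "cond_TT m f" for m f
    proof cases
      case 1
      from iffD2[OF TT_group_iff[OF sys 1] TT] show ?thesis .
    next
      case 2
      from iffD2[OF TT0_group_iff[OF sys 2] TT_imp_TT0[OF TT]] show ?thesis .
    next
      case 3
      with TT0_imp_DO[OF sys ne TT_imp_TT0[OF TT]] show ?thesis
        by (simp only:)
    qed
    then show "not_implies P cond_\<omega>"
      by (rule not_implies_mono[OF TT_not_implies_\<omega>])
  qed
  show "\<forall>Q \<in> {cond_D\<omega>} \<union> TT_group \<union> TT0_group. not_implies cond_\<omega> Q"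
  proof
    fix Q :: "real condition"
    assume "Q \<in> {cond_D\<omega>} \<union> TT_group \<union> TT0_group"
    then consider "Q = cond_D\<omega>" | "Q \<in> TT_group" | "Q \<in> TT0_group"
      by blast
    \<comment> \<open>Dually, every listed \<open>Q\<close> implies \<open>cond_TT0\<close>, so the
      three-point example refutes each of them.\<close>
    then have TT0: "cond_TT0 m f" if sys: "nonautonomous_system m f" and Q: "Q m f" for m f
    proof cases
      case 1
      with Q show ?thesis
        by (simp only: D\<omega>_imp_TT TT_imp_TT0)
    next
      case 2
      from TT_imp_TT0[OF iffD1[OF TT_group_iff[OF sys 2] Q]] show ?thesis .
    next
      case 3
      from iffD1[OF TT0_group_iff[OF sys 3] Q] show ?thesis .
    qed
    show "not_implies cond_\<omega> Q"
      by (rule not_implies_mono[OF \<omega>_not_implies_TT0]) (assumption, erule (1) TT0)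
  qed
qed

end
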